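(* Let $(X,r)$ be a set theoretic involutive non-degenerate square free solution of the Yang-Baxter equation on a finite set $X=\{x_1,\dots,x_n\}$, $n>1$, and assume that the associated group $G_r=\langle \sigma_1,\dots,\sigma_n\rangle\subseteq \operatorname{Sym}_n$ is abelian. Then $(X,r)$ is strongly retractable.
   Context: A set theoretic involutive non-degenerate solution of the Yang-Baxter equation on a finite set $X=\{x_1,\dots,x_n\}$ is a pair $(X,r)$ with $r\colon X^2\to X^2$ such that: (1) $r^2=\mathrm{id}_{X^2}$; (2) for all $i,j\in\{1,\dots,n\}$ there exist unique $k,l\in\{1,\dots,n\}$ with $r(x_i,x_k)=(x_j,x_l)$; (3) $r_{12}\circ r_{23}\circ r_{12}=r_{23}\circ r_{12}\circ r_{23}$, where $r_{ij}\colon X^3\to X^3$ acts as $r$ on the components $(i,j)$ and as the identity on the remaining component. It is square free if $r(x_i,x_i)=(x_i,x_i)$ for all $i$. The maps $\sigma_i,\gamma_i$ on $\{1,\dots,n\}$ defined by $r(x_i,x_k)=(x_{\sigma_i(k)},x_{\gamma_k(i)})$ are bijective. The group $G_r=\langle\sigma_1,\dots,\sigma_n\rangle\subseteq\operatorname{Sym}_n$ is the involutive Yang-Baxter (IYB) group of $(X,r)$; it acts on $X$ by $\sigma(x_i)=x_{\sigma(i)}$. The solution is trivial if $r(x_i,x_j)=(x_j,x_i)$ for all $i,j$ (equivalently, every $\sigma_i$ is the identity). For a square free solution, the relation $\rho$ on $X$ is: $(x_i,x_j)\in\rho$ if and only if $x_i,x_j$ lie in the same $G_r$-orbit on $X$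 and $\sigma_i=\sigma_j$. It is an equivalence relation compatible with $r$, and $\bar r(\overline{x_i},\overline{x_j})=(\overline{x_k},\overline{x_l})$ if $r(x_i,x_j)=(x_k,x_l)$ defines a set theoretic involutive non-degenerate square free solution $Ret_\rho(X,r)=(X/\rho,\bar r)$. The solution $(X,r)$ is strongly retractable if there exists $m\ge 1$ such that applying the operator $Ret_\rho$ $m$ times (at each step using the relation $\rho$ of the current solution) yields a trivial solution. *)

theory Defs
  imports "HOL-Algebra.Group_Action" "HOL-Algebra.Generated_Groups" "HOL-Library.FSet" "HOL-Library.FuncSet"
begin

text \<open>
  A solution is a pair \<open>(X, r)\<close> of a carrier set and a map on pairs. Only the values of \<open>r\<close> on
  \<open>X \<times> X\<close> are relevant. Elements of \<open>X\<close> are used in place of their indices, so that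
  \<open>\<sigma>\<close> below is indexed by \<open>X\<close> and the group is a subgroup of the symmetric group of \<open>X\<close>.
\<close>

type_synonym 'a sol = "'a set \<times> ('a \<times> 'a \<Rightarrow> 'a \<times> 'a)"

definition r12 :: "('a \<times> 'a \<Rightarrow> 'a \<times> 'a) \<Rightarrow> 'a \<times> 'a \<times> 'a \<Rightarrow> 'a \<times> 'a \<times> 'a" where
  "r12 r = (\<lambda>(x, y, z). case r (x, y) of (u, v) \<Rightarrow> (u, v, z))"

definition r23 :: "('a \<times> 'a \<Rightarrow> 'a \<times> 'a) \<Rightarrow> 'a \<times> 'a \<times> 'a \<Rightarrow> 'a \<times> 'a \<times> 'a" where
  "r23 r = (\<lambda>(x, y, z). case r (y, z) of (u, v) \<Rightarrow> (x, u, v))"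

definition ybe_solution :: "'a sol \<Rightarrow> bool" where
  "ybe_solution = (\<lambda>(X, r).
     finite X \<and>
     r \<in> X \<times> X \<rightarrow> X \<times> X \<and>
     (\<forall>p \<in> X \<times> X. r (r p) = p) \<and>
     (\<forall>x\<in>X. \<forall>y\<in>X. \<exists>!p. p \<in> X \<times> X \<and> r (x, fst p) = (y, snd p)) \<and>
     (\<forall>t \<in> X \<times> X \<times> X. (r12 r \<circ> r23 r \<circ> r12 r) t = (r23 r \<circ> r12 r \<circ> r23 r) t))"

definition square_free :: "'a sol \<Rightarrow> bool" where
  "square_free = (\<lambda>(X, r). \<forall>x\<in>X. r (x, x) = (x, x))"

definition trivial_solution :: "'a sol \<Rightarrow> bool" where
  "trivial_solution = (\<lambda>(X, r). \<forall>x\<in>X. \<forall>y\<in>X. r (x, y) = (y, x))"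

text \<open>Restricted to \<open>X\<close>, since the elements of \<^const>\<open>BijGroup\<close> are extensional functions.\<close>

definition sigma :: "'a sol \<Rightarrow> 'a \<Rightarrow> 'a \<Rightarrow> 'a" where
  "sigma = (\<lambda>(X, r) x. \<lambda>y\<in>X. fst (r (x, y)))"

definition IYB_group :: "'a sol \<Rightarrow> ('a \<Rightarrow> 'a) monoid" where
  "IYB_group S = BijGroup (fst S) \<lparr>carrier := generate (BijGroup (fst S)) (sigma S ` fst S)\<rparr>"

definition rho :: "'a sol \<Rightarrow> ('a \<times> 'a) set" where
  "rho S = {(x, y). x \<in> fst S \<and> y \<in> fst S \<and>
     (\<exists>A \<in> orbits (IYB_group S) (fst S) (\<lambda>g. g). x \<in> A \<and> y \<in> A) \<and>
     sigma S x = sigma S y}"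

text \<open>The induced map on classes; the description is uniquely satisfied because \<^const>\<open>rho\<close> is
  compatible with \<open>r\<close> for square free solutions.\<close>

definition ret_map :: "'a sol \<Rightarrow> 'a set \<times> 'a set \<Rightarrow> 'a set \<times> 'a set" where
  "ret_map S = (\<lambda>(A, B). THE (C, D). \<exists>x\<in>A. \<exists>y\<in>B. \<exists>k l.
     snd S (x, y) = (k, l) \<and> C = rho S `` {k} \<and> D = rho S `` {l})"

definition Ret :: "'a sol \<Rightarrow> 'a set sol" where
  "Ret S = (fst S // rho S, ret_map S)"

text \<open>
  \<^const>\<open>Ret\<close> raises the type from \<open>'a\<close> to \<open>'a set\<close>, so it cannot be iterated a variable number of
  times as it stands. The type below contains \<open>'a\<close> together with all finitely nested finite
  sets over it; transporting \<^const>\<open>Ret\<close> along the injection of finite sets into this type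
  gives an operator on a single type.
\<close>

datatype 'a nested = Elem 'a | Class "'a nested fset"

definition transport :: "('a \<Rightarrow> 'b) \<Rightarrow> 'a sol \<Rightarrow> 'b sol" where
  "transport f = (\<lambda>(X, r).
     (f ` X, map_prod f f \<circ> r \<circ> map_prod (inv_into X f) (inv_into X f)))"

definition Ret_nested :: "'a nested sol \<Rightarrow> 'a nested sol" where
  "Ret_nested S = transport (\<lambda>A. Class (Abs_fset A)) (Ret S)"

definition strongly_retractable :: "'a sol \<Rightarrow> bool" where
  "strongly_retractable S \<longleftrightarrow>
     (\<exists>m\<ge>1. trivial_solution ((Ret_nested ^^ m) (transport Elem S)))"

end

theory Submission
  imports Defs "HOL-Combinatorics.Cycles"
begin

text \<open>
  Write \<open>D\<^sub>x = \<sigma>\<^sub>x\<inverse>\<close>. The braid relation together with commutativity of the \<open>\<sigma>\<^sub>x\<close> gives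
  \<open>D\<^sub>x D\<^bsub>D\<^sub>x y\<^esub> = D\<^sub>y D\<^bsub>D\<^sub>y x\<^esub>\<close>, and square freeness says \<open>D\<^sub>x x = x\<close>. Let \<open>G\<close> be the abelian group
  generated by the \<open>D\<^sub>x\<close>; an element of \<open>G\<close> that fixes a point fixes its whole orbit.

  The heart of the matter is that a nontrivial such solution has two distinct points in one orbit
  with equal permutations. Suppose not, so that \<open>x \<mapsto> D\<^sub>x\<close> is injective on orbits
  (\<open>separated_imp_trivial\<close>). Given \<open>g \<in> G\<close> and a point \<open>y\<close> that it moves, put
  \<open>h = D\<^bsub>g y\<^esub> D\<^sub>y\<inverse>\<close>. Then \<open>h \<noteq> 1\<close> by injectivity, and \<open>h\<close> fixes \<open>y\<close> because both factors do. The
  crucial point, \<open>fixed_point_persists\<close>, is that \<open>h\<close> also fixes every fixed point of \<open>g\<close>. Hence \<open>h\<close>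
  has fewer moved points than \<open>g\<close>, and by descent \<open>G\<close> is trivial. Behind this is a ring: an
  abelian IYB group is the adjoint group of a commutative nilpotent ring, in which \<open>h\<close> is, up to sign,
  the product of \<open>g\<close> and \<open>D\<^sub>y\<close>, and square freeness makes the generators \<open>D\<^sub>y\<close> square to zero. The
  argument below uses only the one instance of associativity and commutativity that is
  needed, in the form of the invariance statement \<open>F_invariant\<close>.

  Hence the relation \<open>\<rho>\<close> of a nontrivial solution identifies two points. The retraction is a
  homomorphic image (\<open>Ret_nested_image\<close>), and homomorphic images inherit all hypotheses
  (\<open>abelian_sqfree_image\<close>), so retracting repeatedly shrinks the set until the solution is
  trivial.
\<close>

section \<open>Commuting square free cycle sets\<close>

locale abelian_cycle_set =
  fixes X :: "'a set" and D :: "'a \<Rightarrow> 'a \<Rightarrow> 'a"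
  assumes finite_X: "finite X"
    and perm: "x \<in> X \<Longrightarrow> D x permutes X"
    and idem: "x \<in> X \<Longrightarrow> D x x = x"
    and comm: "x \<in> X \<Longrightarrow> y \<in> X \<Longrightarrow> D x (D y z) = D y (D x z)"
    and cyc: "x \<in> X \<Longrightarrow> y \<in> X \<Longrightarrow> D x (D (D x y) z) = D y (D (D y x) z)"
begin

lemma closed [simp]: "x \<in> X \<Longrightarrow> y \<in> X \<Longrightarrow> D x y \<in> X"
  using perm permutes_in_image by metis

lemma inj_D: "x \<in> X \<Longrightarrow> D x y = D x z \<Longrightarrow> y = z"
  using permutes_inj[OF perm] by (auto dest: injD)

lemma surj_D:
  assumes "x \<in> X" "y \<in> X"
  obtains z where "z \<in> X" "D x z = y"
  using permutes_image[OF perm[OF assms(1)]] assms(2) by (metis imageE)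

lemma finite_order:
  assumes "x \<in> X"
  obtains n where "\<And>y. (D x ^^ n) (D x y) = y"
proof -
  have "permutation (D x)" using perm[OF assms] finite_X permutation_permutes by blast
  then obtain n where n: "(D x ^^ n) = id" "n > 0" using permutation_is_nilpotent by blast
  then obtain m where "n = Suc m" by (cases n) auto
  with n(1) have "(D x ^^ m) (D x y) = y" for y
    by (metis comp_apply funpow_Suc_right id_apply)
  then show thesis using that by blast
qed

text \<open>
  Since every generator has finite order, closing under the generators alone already gives a group.
\<close>
inductive_set G :: "('a \<Rightarrow> 'a) set" where
  G_id: "id \<in> G"
| G_step: "t \<in> X \<Longrightarrow> g \<in> G \<Longrightarrow> D t \<circ> g \<in> G"

lemma G_closed: "g \<in> G \<Longrightarrow> x \<in> X \<Longrightarrow> g x \<in> X"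
  by (induction rule: G.induct) auto

lemma G_comm: "g \<in> G \<Longrightarrow> t \<in> X \<Longrightarrow> g (D t z) = D t (g z)"
  by (induction rule: G.induct) (auto simp: comm)

lemma G_inj: "g \<in> G \<Longrightarrow> g y = g z \<Longrightarrow> y = z"
  by (induction rule: G.induct) (auto dest: inj_D)

lemma G_outside: "g \<in> G \<Longrightarrow> y \<notin> X \<Longrightarrow> g y = y"
  by (induction rule: G.induct) (auto simp: permutes_not_in[OF perm])

lemma G_D: "t \<in> X \<Longrightarrow> D t \<in> G"
  using G_step[OF _ G_id] by simp

lemma G_comp: "g \<in> G \<Longrightarrow> h \<in> G \<Longrightarrow> g \<circ> h \<in> G"
  by (induction rule: G.induct) (auto simp: comp_assoc intro: G_step)

lemma G_pow: "t \<in> X \<Longrightarrow> D t ^^ n \<in> G"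
  by (induction n) (auto simp: G_id G_step simp flip: id_def)

text \<open>
  Up to inversion, the permutation attached to the multiset \<open>{u, w}\<close> by the bijective cocycle of the structure group;
  axiom \<open>cyc\<close> is its symmetry in \<open>u\<close> and \<open>w\<close>.
\<close>
definition F :: "'a \<Rightarrow> 'a \<Rightarrow> 'a \<Rightarrow> 'a" where
  "F u w z = D u (D (D u w) z)"

text \<open>
  The point is that \<open>D\<^sub>t u\<close> and \<open>D\<^sub>t w\<close> enter the right-hand side through the permutation \<open>F u w\<close> only.
  It comes from computing the permutation of \<open>{t, u, w}\<close> in two orders.
\<close>
lemma F_shift:
  assumes "t \<in> X" "u \<in> X" "w \<in> X"
  shows "D t (F (D t u) (D t w) z) = F u w (D (F u w t) z)"
proof -
  let ?a = "D (D t u) (D t w)"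
  have a: "?a = D (D u t) (D u w)"
    using assms by (metis closed comm cyc)
  have b: "D (D u w) (D u t) = F u w t"
    using assms by (simp add: F_def comm)
  have "D t (F (D t u) (D t w) z) = D u (D (D u t) (D ?a z))"
    using assms by (simp add: F_def cyc)
  also have "\<dots> = D u (D (D u w) (D (D (D u w) (D u t)) z))"
    unfolding a using assms cyc[of "D u t" "D u w"] by simp
  finally show ?thesis by (simp add: b) (simp add: F_def)
qed

text \<open>
  In the associated ring, equality of the two sums \<open>u + w\<close> and \<open>u' + w'\<close> is preserved by the
  action of \<open>G\<close>, which is by additive maps.
\<close>
lemma F_invariant:
  assumes "g \<in> G" "u \<in> X" "w \<in> X" "u' \<in> X" "w' \<in> X" "F u w = F u' w'"
  shows "F (g u) (g w) = F (g u') (g w')"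
  using assms
proof (induction rule: G.induct)
  case (G_step t g)
  have "D t (F (D t (g u)) (D t (g w)) z) = D t (F (D t (g u')) (D t (g w')) z)" for z
    using G_step by (simp add: F_shift G_closed)
  then show ?case using inj_D[OF G_step(1)] by (auto simp: fun_eq_iff)
qed simp

text \<open>
  This is what makes equality of permutations a congruence.
\<close>
lemma D_eq_shift:
  assumes "g \<in> G" "u \<in> X" "u' \<in> X" "D u = D u'"
  shows "D (g u) = D (g u')"
  using assms
proof (induction rule: G.induct)
  case (G_step t g)
  have eq: "D (g u) = D (g u')" using G_step by simp
  have "D t (D (D t (g u)) z) = D t (D (D t (g u')) z)" for z
    using G_step eq cyc[of t "g u" z] cyc[of t "g u'" z] by (simp add: G_closed)
  then show ?case using inj_D[OF G_step(1)] by (auto simp: fun_eq_iff)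
qed simp

text \<open>
  Here \<open>h = D\<^bsub>g y\<^esub> D\<^sub>y\<inverse>\<close>. Choose \<open>a\<close>, \<open>b\<close> with \<open>D\<^sub>x a = y\<close> and \<open>D\<^sub>y b = x\<close>. Then \<open>F x a = D\<^sub>x D\<^sub>y = F y b\<close>,
  and applying \<open>g\<close>, which fixes \<open>x\<close> and hence \<open>b\<close>, shows that the composite of \<open>D\<^sub>x\<close> and \<open>D\<^bsub>g y\<^esub>\<close> equals
  that of \<open>D\<^bsub>g y\<^esub>\<close> and the permutation attached to \<open>D\<^bsub>g y\<^esub> b = h x\<close>. Cancelling \<open>D\<^bsub>g y\<^esub>\<close> and using
  injectivity on the orbit of \<open>x\<close> finishes the proof.
\<close>
lemma fixed_point_persists:
  assumes g: "g \<in> G" and x: "x \<in> X" and y: "y \<in> X" and h: "h \<in> G"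
    and inv: "\<And>z. h (D y z) = D (g y) z"
    and fix_x: "g x = x"
    and separated: "\<And>k x. k \<in> G \<Longrightarrow> x \<in> X \<Longrightarrow> D (k x) = D x \<Longrightarrow> k x = x"
  shows "h x = x"
proof -
  obtain a where a: "a \<in> X" "D x a = y" using surj_D x y by metis
  obtain b where b: "b \<in> X" "D y b = x" using surj_D x y by metis
  have gy: "g y \<in> X" using g y by (rule G_closed)
  have "F x a = F y b"
    using x y a(2) b(2) by (auto simp: F_def fun_eq_iff comm)
  then have eq: "F (g x) (g a) = F (g y) (g b)"
    using F_invariant g x y a(1) b(1) by blast
  have gb: "g b = b"
    using g y b fix_x inj_D[OF y] by (metis G_comm)
  have ga: "D x (g a) = g y"
    using G_comm[OF g x, of a] a by simp
  have "D (g y) (D x z) = D (g y) (D (D (g y) b) z)" for z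
    using fun_cong[OF eq, of z] by (simp add: F_def fix_x ga gb comm x gy)
  then have "D x = D (D (g y) b)"
    using inj_D[OF gy] by (auto simp: fun_eq_iff)
  also have "D (g y) b = h x" using inv[of b] b by simp
  finally have "D (h x) = D x" by simp
  then show ?thesis by (rule separated[OF h x])
qed

text \<open>
  Descent on the number of moved points: \<open>h = D\<^bsub>g y\<^esub> D\<^sub>y\<inverse>\<close> fixes all that \<open>g\<close> fixes and also \<open>y\<close>, so
  \<open>h\<close> is the identity, that is \<open>D\<^bsub>g y\<^esub> = D\<^sub>y\<close>, although \<open>g\<close> moves \<open>y\<close> within its orbit.
\<close>
lemma separated_imp_trivial:
  assumes separated: "\<And>k x. k \<in> G \<Longrightarrow> x \<in> X \<Longrightarrow> D (k x) = D x \<Longrightarrow> k x = x"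
  assumes "g \<in> G"
  shows "g = id"
  using assms(2)
proof (induction "card {x \<in> X. g x \<noteq> x}" arbitrary: g rule: less_induct)
  case less
  show ?case
  proof (rule ccontr)
    assume "g \<noteq> id"
    then obtain y where y: "y \<in> X" "g y \<noteq> y"
      using G_outside[OF less.prems] by (auto simp: fun_eq_iff)
    have gy: "g y \<in> X" using less.prems y(1) by (rule G_closed)
    obtain n where n: "\<And>z. (D y ^^ n) (D y z) = z" using finite_order[OF y(1)] by blast
    \<comment> \<open>\<open>D y ^^ n\<close> is the inverse of \<open>D y\<close>, written as an element of \<open>G\<close>.\<close>
    define h where "h = D (g y) \<circ> (D y ^^ n)"
    have h: "h \<in> G" unfolding h_def by (intro G_comp G_D G_pow gy y)
    have inv: "h (D y z) = D (g y) z" for z by (simp add: h_def n)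
    have keep: "h x = x" if "x \<in> X" "g x = x" for x
      by (rule fixed_point_persists[of g x y h]) (fact less.prems that y(1) h inv separated)+
    have "g (D (g y) y) = g y"
      using less.prems y(1) gy idem[OF gy] by (simp add: G_comm)
    then have "D (g y) y = y" by (rule G_inj[OF less.prems])
    then have "h y = y" using inv[of y] y(1) by (simp add: idem)
    then have "{x \<in> X. h x \<noteq> x} \<subset> {x \<in> X. g x \<noteq> x}" using keep y by blast
    then have "h = id" using less.hyps[OF _ h] finite_X by (simp add: psubset_card_mono)
    then have "D (g y) = D y" using inv by (auto simp: fun_eq_iff)
    then show False using separated[OF less.prems y(1)] y(2) by blast
  qed
qed

end

section \<open>Solutions with commuting sigma maps\<close>

definition abelian_sqfree :: "'a sol \<Rightarrow> bool" where
  "abelian_sqfree S \<longleftrightarrow> ybe_solution S \<and> square_free S \<and>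
     (\<forall>x\<in>fst S. \<forall>y\<in>fst S. \<forall>z\<in>fst S.
        sigma S x (sigma S y z) = sigma S y (sigma S x z))"

text \<open>Extended by the identity outside of \<open>X\<close>, so that it is a permutation in the sense of
  \<^const>\<open>permutes\<close>; the maps \<open>sigma S x\<close> themselves are extensional.\<close>
definition ldiv :: "'a sol \<Rightarrow> 'a \<Rightarrow> 'a \<Rightarrow> 'a" where
  "ldiv S x y = (if y \<in> fst S then inv_into (fst S) (sigma S x) y else y)"

lemma solutionD:
  assumes "ybe_solution (X, r)"
  shows "finite X"
    and "x \<in> X \<Longrightarrow> y \<in> X \<Longrightarrow> r (x, y) \<in> X \<times> X"
    and "x \<in> X \<Longrightarrow> y \<in> X \<Longrightarrow> r (r (x, y)) = (x, y)"
    and "x \<in> X \<Longrightarrow> y \<in> X \<Longrightarrow> \<exists>!p. p \<in> X \<times> X \<and> r (x, fst p) = (y, snd p)"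
    and "x \<in> X \<Longrightarrow> y \<in> X \<Longrightarrow> z \<in> X \<Longrightarrow>
      r12 r (r23 r (r12 r (x, y, z))) = r23 r (r12 r (r23 r (x, y, z)))"
  using assms unfolding ybe_solution_def by auto

lemma sigma_apply [simp]: "y \<in> X \<Longrightarrow> sigma (X, r) x y = fst (r (x, y))"
  by (simp add: sigma_def)

text \<open>
  The non-degeneracy condition gives surjectivity onto the finite set \<open>X\<close>.
\<close>
lemma sigma_bij:
  assumes S: "ybe_solution (X, r)" and x: "x \<in> X"
  shows "bij_betw (sigma (X, r) x) X X"
proof -
  have "sigma (X, r) x ` X = X"
  proof
    show "sigma (X, r) x ` X \<subseteq> X" using solutionD(2)[OF S x] by fastforce
    show "X \<subseteq> sigma (X, r) x ` X"
    proof
      fix y assume "y \<in> X"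
      then obtain p where p: "p \<in> X \<times> X" "r (x, fst p) = (y, snd p)"
        using solutionD(4)[OF S x] by blast
      then have "y = sigma (X, r) x (fst p)" by auto
      then show "y \<in> sigma (X, r) x ` X" using p(1) by auto
    qed
  qed
  then show ?thesis
    using solutionD(1)[OF S] by (simp add: bij_betw_def eq_card_imp_inj_on)
qed

context
  fixes X :: "'a set" and r
  assumes S: "ybe_solution (X, r)"
begin

lemma ldiv_sigma: "x \<in> X \<Longrightarrow> y \<in> X \<Longrightarrow> ldiv (X, r) x (fst (r (x, y))) = y"
  using inv_into_f_f[OF bij_betw_imp_inj_on[OF sigma_bij[OF S]], of x y] solutionD(2)[OF S, of x y]
  by (auto simp: ldiv_def mem_Times_iff)

lemma sigma_ldiv: "x \<in> X \<Longrightarrow> y \<in> X \<Longrightarrow> fst (r (x, ldiv (X, r) x y)) = y"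
  and ldiv_closed: "x \<in> X \<Longrightarrow> y \<in> X \<Longrightarrow> ldiv (X, r) x y \<in> X"
proof -
  assume xy: "x \<in> X" "y \<in> X"
  have im: "y \<in> sigma (X, r) x ` X" using sigma_bij[OF S xy(1)] xy(2) by (simp add: bij_betw_def)
  show "ldiv (X, r) x y \<in> X" using inv_into_into[OF im] xy by (simp add: ldiv_def)
  then show "fst (r (x, ldiv (X, r) x y)) = y" using f_inv_into_f[OF im] xy by (simp add: ldiv_def)
qed

lemma ldiv_permutes: "x \<in> X \<Longrightarrow> ldiv (X, r) x permutes X"
  by (rule bij_imp_permutes)
    (auto simp: ldiv_def intro!: bij_betw_cong[THEN iffD1, OF _ bij_betw_inv_into[OF sigma_bij[OF S]]])

text \<open>
  By involutivity, the second component of \<open>r\<close> is determined by the first.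
\<close>
lemma snd_eq_ldiv:
  assumes "x \<in> X" "y \<in> X"
  shows "snd (r (x, y)) = ldiv (X, r) (fst (r (x, y))) x"
proof -
  obtain k l where kl: "r (x, y) = (k, l)" "k \<in> X" "l \<in> X"
    using solutionD(2)[OF S assms] by blast
  then have "r (k, l) = (x, y)" using solutionD(3)[OF S assms] by simp
  then show ?thesis using ldiv_sigma[of k l] kl by simp
qed

lemma ldiv_eq_iff_sigma_eq:
  assumes "x \<in> X" "x' \<in> X"
  shows "ldiv (X, r) x = ldiv (X, r) x' \<longleftrightarrow> sigma (X, r) x = sigma (X, r) x'"
proof
  assume eq: "ldiv (X, r) x = ldiv (X, r) x'"
  have "fst (r (x, y)) = fst (r (x', y))" if "y \<in> X" for y
    using ldiv_sigma[OF assms(1) that] sigma_ldiv[OF assms(2), of "fst (r (x, y))"]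
      solutionD(2)[OF S assms(1) that] eq by (auto simp: mem_Times_iff)
  then show "sigma (X, r) x = sigma (X, r) x'" by (auto simp: sigma_def)
qed (rule ext, simp add: ldiv_def)

lemma sigma_ybe:
  assumes "x \<in> X" "y \<in> X" "z \<in> X" "r (x, y) = (k, l)"
  shows "fst (r (x, fst (r (y, z)))) = fst (r (k, fst (r (l, z))))"
  using arg_cong[OF solutionD(5)[OF S assms(1-3)], of fst] assms(4)
  by (auto simp: r12_def r23_def split: prod.splits)

end

text \<open>
  The first component of the braid relation at \<open>(x, \<sigma>\<^sub>x\<inverse> y)\<close> reads
  \<open>\<sigma>\<^sub>x \<sigma>\<^sub>u = \<sigma>\<^sub>y \<sigma>\<^sub>v\<close> with \<open>u = \<sigma>\<^sub>x\<inverse> y\<close>, \<open>v = \<sigma>\<^sub>y\<inverse> x\<close>. Inverting it reverses both products, which is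
  undone by commutativity.
\<close>
lemma abelian_cycle_set_ldiv:
  assumes "abelian_sqfree (X, r)"
  shows "abelian_cycle_set X (ldiv (X, r))"
proof -
  let ?D = "ldiv (X, r)" and ?s = "\<lambda>x y. fst (r (x, y))"
  have S: "ybe_solution (X, r)" and sf: "square_free (X, r)"
    and com: "\<And>x y z. x \<in> X \<Longrightarrow> y \<in> X \<Longrightarrow> z \<in> X \<Longrightarrow> ?s x (?s y z) = ?s y (?s x z)"
    using assms solutionD(2)[of X r] by (fastforce simp: abelian_sqfree_def mem_Times_iff)+
  note [simp] = ldiv_closed[OF S] sigma_ldiv[OF S] ldiv_sigma[OF S]
  have cl [simp]: "?s x y \<in> X" if "x \<in> X" "y \<in> X" for x y
    using solutionD(2)[OF S that] by (auto simp: mem_Times_iff)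
  have uniq: "?D x y = w" if "?s x w = y" "w \<in> X" "x \<in> X" for x y w
    using that by auto
  show ?thesis
  proof
    show "finite X" using S by (rule solutionD)
    fix x assume x: "x \<in> X"
    show "?D x permutes X" using ldiv_permutes[OF S x] .
    show "?D x x = x" using sf x by (intro uniq) (auto simp: square_free_def)
    fix y z assume y: "y \<in> X"
    have D2: "?D a (?D b z) = w" if "?s b (?s a w) = z" "a \<in> X" "b \<in> X" "w \<in> X" for a b w z
      using that by auto
    show "?D x (?D y z) = ?D y (?D x z)"
    proof (cases "z \<in> X")
      case True
      then show ?thesis using x y by (intro D2) (auto simp: com[of y x])
    qed (simp add: ldiv_def)
    show "?D x (?D (?D x y) z) = ?D y (?D (?D y x) z)"
    proof (cases "z \<in> X")
      case True
      define w where "w = ?D y (?D (?D y x) z)"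
      have w: "w \<in> X" "?s (?D y x) (?s y w) = z" using x y True by (auto simp: w_def)
      have r: "r (x, ?D x y) = (y, ?D y x)"
        using snd_eq_ldiv[OF S x, of "?D x y"] x y by (simp add: prod_eq_iff)
      have "?s (?D x y) (?s x w) = ?s x (?s (?D x y) w)" using x y w by (intro com) auto
      also have "\<dots> = ?s y (?s (?D y x) w)" using x y w by (intro sigma_ybe[OF S _ _ _ r]) auto
      also have "\<dots> = ?s (?D y x) (?s y w)" using x y w by (intro com) auto
      finally show ?thesis using w x y unfolding w_def[symmetric] by (intro D2) auto
    qed (simp add: ldiv_def)
  qed
qed

section \<open>Orbits of the IYB group and the retraction relation\<close>

definition same_orbit :: "'a sol \<Rightarrow> ('a \<times> 'a) set" where
  "same_orbit S = {(x, y). x \<in> fst S \<and> y \<in> fst S \<and>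
     (\<exists>A \<in> orbits (IYB_group S) (fst S) (\<lambda>g. g). x \<in> A \<and> y \<in> A)}"

lemma rho_eq: "rho S = {(x, y). (x, y) \<in> same_orbit S \<and> sigma S x = sigma S y}"
  by (auto simp: rho_def same_orbit_def)

lemma sigma_in_Bij: "ybe_solution (X, r) \<Longrightarrow> x \<in> X \<Longrightarrow> sigma (X, r) x \<in> Bij X"
  using sigma_bij by (auto simp: Bij_def sigma_def)

lemma IYB_group_action:
  assumes S: "ybe_solution (X, r)"
  shows "group_action (IYB_group (X, r)) X (\<lambda>g. g)"
proof -
  interpret B: group "BijGroup X" by (rule group_BijGroup)
  have "sigma (X, r) ` X \<subseteq> carrier (BijGroup X)"
    using sigma_in_Bij[OF S] by (auto simp: BijGroup_def)
  then have sub: "subgroup (generate (BijGroup X) (sigma (X, r) ` X)) (BijGroup X)"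
    by (rule B.generate_is_subgroup)
  have "group (IYB_group (X, r))"
    using subgroup.subgroup_is_group[OF sub B.group_axioms] by (simp add: IYB_group_def)
  moreover have "(\<lambda>g. g) \<in> hom (IYB_group (X, r)) (BijGroup X)"
    using subgroup.subset[OF sub] by (auto simp: hom_def IYB_group_def)
  ultimately show ?thesis
    using B.group_axioms by (simp add: group_action_def group_hom_def group_hom_axioms_def)
qed

lemma same_orbit_equiv:
  assumes "ybe_solution (X, r)"
  shows "equiv X (same_orbit (X, r))"
proof -
  interpret group_action "IYB_group (X, r)" X "\<lambda>g. g" using assms by (rule IYB_group_action)
  let ?Orbs = "orbits (IYB_group (X, r)) X (\<lambda>g. g)"
  show ?thesis
  proof (rule equivI)
    show "refl_on X (same_orbit (X, r))"
      using orbits_coverture unfolding refl_on_def same_orbit_def by fastforce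
    show "sym (same_orbit (X, r))" unfolding sym_def same_orbit_def by blast
    show "trans (same_orbit (X, r))"
    proof (rule transI)
      fix x y z assume "(x, y) \<in> same_orbit (X, r)" "(y, z) \<in> same_orbit (X, r)"
      then obtain A B where AB: "A \<in> ?Orbs" "B \<in> ?Orbs" "x \<in> A" "y \<in> A" "y \<in> B" "z \<in> B"
        and "x \<in> X" "z \<in> X"
        unfolding same_orbit_def by auto
      then have "A = B" using disjoint_union[of A B] by blast
      then show "(x, z) \<in> same_orbit (X, r)"
        using AB \<open>x \<in> X\<close> \<open>z \<in> X\<close> unfolding same_orbit_def by auto
    qed
  qed (auto simp: same_orbit_def)
qed

lemma same_orbit_sigma:
  assumes S: "ybe_solution (X, r)" and t: "t \<in> X" and x: "x \<in> X"
  shows "(x, fst (r (t, x))) \<in> same_orbit (X, r)"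
proof -
  interpret group_action "IYB_group (X, r)" X "\<lambda>g. g" using S by (rule IYB_group_action)
  let ?O = "orbit (IYB_group (X, r)) (\<lambda>g. g) x"
  have "sigma (X, r) t \<in> carrier (IYB_group (X, r))"
    using t by (auto simp: IYB_group_def intro: generate.incl)
  then have "sigma (X, r) t x \<in> ?O" unfolding orbit_def by blast
  moreover have "x \<in> ?O" using orbit_refl[OF x] .
  moreover have "fst (r (t, x)) \<in> X" using solutionD(2)[OF S t x] by auto
  ultimately show ?thesis using x by (auto simp: same_orbit_def orbits_def)
qed

lemma rho_equiv:
  assumes "ybe_solution (X, r)"
  shows "equiv X (rho (X, r))"
proof -
  have refl: "refl_on X (same_orbit (X, r))" and sym: "sym (same_orbit (X, r))"
    and trans: "trans (same_orbit (X, r))"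
    using same_orbit_equiv[OF assms] by (auto elim: equivE)
  show ?thesis
  proof (rule equivI)
    show "refl_on X (rho (X, r))" using refl by (simp add: rho_eq refl_on_def)
    show "sym (rho (X, r))" by (rule symI) (use symD[OF sym] in \<open>auto simp: rho_eq\<close>)
    show "trans (rho (X, r))" by (rule transI) (use transD[OF trans] in \<open>auto simp: rho_eq\<close>)
  qed (auto simp: rho_def)
qed

lemma same_orbit_ldiv:
  assumes S: "ybe_solution (X, r)" and t: "t \<in> X" and x: "x \<in> X"
  shows "(x, ldiv (X, r) t x) \<in> same_orbit (X, r)"
proof -
  have "sym (same_orbit (X, r))" using same_orbit_equiv[OF S] by (simp add: equiv_def)
  moreover have "(ldiv (X, r) t x, x) \<in> same_orbit (X, r)"
    using same_orbit_sigma[OF S t ldiv_closed[OF S t x]] by (simp add: sigma_ldiv[OF S t x])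
  ultimately show ?thesis by (rule symD)
qed

text \<open>
  Both components of \<open>r\<close> move a point within its orbit, so only equality of the permutations is at
  stake. It is preserved by \<open>D_eq_shift\<close>; for the first component, \<open>\<sigma>\<^sub>x\<close> is a power of its inverse.
\<close>
lemma rho_compatible:
  assumes A: "abelian_sqfree (X, r)"
    and x: "(x, x') \<in> rho (X, r)" and y: "(y, y') \<in> rho (X, r)"
  shows "(fst (r (x, y)), fst (r (x', y'))) \<in> rho (X, r)"
    and "(snd (r (x, y)), snd (r (x', y'))) \<in> rho (X, r)"
proof -
  interpret abelian_cycle_set X "ldiv (X, r)" using A by (rule abelian_cycle_set_ldiv)
  have S: "ybe_solution (X, r)" using A by (simp add: abelian_sqfree_def)
  have sym: "sym (same_orbit (X, r))" and trans: "trans (same_orbit (X, r))"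
    using same_orbit_equiv[OF S] by (auto elim: equivE)
  have orb: "(a', b') \<in> same_orbit (X, r)"
    if "(a, b) \<in> same_orbit (X, r)" "(a, a') \<in> same_orbit (X, r)" "(b, b') \<in> same_orbit (X, r)"
    for a b a' b'
    using transD[OF trans symD[OF sym that(2)] transD[OF trans that(1,3)]] .
  have mem: "x \<in> X" "x' \<in> X" "y \<in> X" "y' \<in> X"
    and xo: "(x, x') \<in> same_orbit (X, r)" and yo: "(y, y') \<in> same_orbit (X, r)"
    and sx: "sigma (X, r) x = sigma (X, r) x'" and sy: "sigma (X, r) y = sigma (X, r) y'"
    using x y by (simp_all add: rho_def same_orbit_def)
  have Dx: "ldiv (X, r) x = ldiv (X, r) x'" and Dy: "ldiv (X, r) y = ldiv (X, r) y'"
    using sx sy mem by (simp_all only: ldiv_eq_iff_sigma_eq[OF S])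
  have k_mem: "fst (r (x, y)) \<in> X" "fst (r (x', y')) \<in> X"
    using solutionD(2)[OF S mem(1,3)] solutionD(2)[OF S mem(2,4)] by (simp_all add: mem_Times_iff)
  obtain n where n: "\<And>z. (ldiv (X, r) x ^^ n) (ldiv (X, r) x z) = z"
    using finite_order[OF mem(1)] by blast
  have k_pow: "fst (r (x, z)) = (ldiv (X, r) x ^^ n) z" if "z \<in> X" for z
    using n[of "fst (r (x, z))"] ldiv_sigma[OF S mem(1) that] by simp
  have k': "fst (r (x', y')) = fst (r (x, y'))"
    using fun_cong[OF sx, of y'] mem by simp
  have "ldiv (X, r) (fst (r (x, y))) = ldiv (X, r) (fst (r (x', y')))"
    unfolding k' k_pow[OF mem(3)] k_pow[OF mem(4)]
    by (rule D_eq_shift[OF G_pow[OF mem(1)] mem(3,4) Dy])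
  note kD = this
  have "(fst (r (x, y)), fst (r (x', y'))) \<in> same_orbit (X, r)"
    by (rule orb[OF yo]) (rule same_orbit_sigma[OF S], fact mem, fact mem)+
  then show "(fst (r (x, y)), fst (r (x', y'))) \<in> rho (X, r)"
    using kD ldiv_eq_iff_sigma_eq[OF S k_mem] by (simp add: rho_eq)
  have l: "snd (r (x, y)) = ldiv (X, r) (fst (r (x, y))) x"
    "snd (r (x', y')) = ldiv (X, r) (fst (r (x, y))) x'"
    using snd_eq_ldiv[OF S mem(1,3)] snd_eq_ldiv[OF S mem(2,4)] kD by simp_all
  have l_mem: "snd (r (x, y)) \<in> X" "snd (r (x', y')) \<in> X"
    using solutionD(2)[OF S mem(1,3)] solutionD(2)[OF S mem(2,4)] by (simp_all add: mem_Times_iff)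
  have "ldiv (X, r) (snd (r (x, y))) = ldiv (X, r) (snd (r (x', y')))"
    unfolding l
    by (rule D_eq_shift[OF G_D[OF k_mem(1)] mem(1,2) Dx])
  moreover have "(snd (r (x, y)), snd (r (x', y'))) \<in> same_orbit (X, r)"
    unfolding l by (rule orb[OF xo]) (rule same_orbit_ldiv[OF S k_mem(1)], fact mem)+
  ultimately show "(snd (r (x, y)), snd (r (x', y'))) \<in> rho (X, r)"
    using ldiv_eq_iff_sigma_eq[OF S l_mem] by (simp add: rho_eq)
qed

text \<open>
  If \<open>\<rho>\<close> were equality, then the permutations would be injective on orbits, so all of them
  would be the identity.
\<close>
lemma nontrivial_imp_rho_nontrivial:
  assumes A: "abelian_sqfree (X, r)" and "\<not> trivial_solution (X, r)"
  shows "\<exists>x y. (x, y) \<in> rho (X, r) \<and> x \<noteq> y"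
proof (rule ccontr)
  assume contra: "\<nexists>x y. (x, y) \<in> rho (X, r) \<and> x \<noteq> y"
  then have no: "x = y" if "(x, y) \<in> rho (X, r)" for x y using that by blast
  interpret abelian_cycle_set X "ldiv (X, r)" using A by (rule abelian_cycle_set_ldiv)
  have S: "ybe_solution (X, r)" using A by (simp add: abelian_sqfree_def)
  have refl: "refl_on X (same_orbit (X, r))" and trans: "trans (same_orbit (X, r))"
    using same_orbit_equiv[OF S] by (auto elim: equivE)
  have orb: "(x, g x) \<in> same_orbit (X, r)" if "g \<in> G" "x \<in> X" for g x
    using that
  proof (induction rule: G.induct)
    case G_id
    then show ?case using refl by (simp add: refl_on_def)
  next
    case (G_step t g)
    then show ?case
      using trans same_orbit_ldiv[OF S G_step(1) G_closed[OF G_step(2)]]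
      by (auto dest: transD)
  qed
  have "ldiv (X, r) t = id" if t: "t \<in> X" for t
  proof (rule separated_imp_trivial[OF _ G_D[OF t]])
    fix g x assume g: "g \<in> G" "x \<in> X" "ldiv (X, r) (g x) = ldiv (X, r) x"
    then have "(x, g x) \<in> rho (X, r)"
      using orb[OF g(1,2)] ldiv_eq_iff_sigma_eq[OF S G_closed[OF g(1,2)] g(2)] by (simp add: rho_eq)
    then show "g x = x" using no[of x "g x"] by simp
  qed
  then have "r (x, y) = (y, x)" if "x \<in> X" "y \<in> X" for x y
    using that sigma_ldiv[OF S that] snd_eq_ldiv[OF S that] by (auto simp: prod_eq_iff)
  then show False using assms(2) by (auto simp: trivial_solution_def)
qed

section \<open>Homomorphic images\<close>

text \<open>
  Every condition is an identity that passes to images, except the non-degeneracy. For that one, the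
  induced \<open>\<sigma>\<close> maps are surjective, hence bijective by finiteness, and the second component
  of the required pair is forced by the first.
\<close>
lemma abelian_sqfree_image:
  assumes A: "abelian_sqfree (X, r)"
    and hom: "\<And>x y. x \<in> X \<Longrightarrow> y \<in> X \<Longrightarrow> r' (q x, q y) = map_prod q q (r (x, y))"
  shows "abelian_sqfree (q ` X, r')"
proof -
  have S: "ybe_solution (X, r)" and sf: "square_free (X, r)" using A by (auto simp: abelian_sqfree_def)
  have cl: "fst (r (x, y)) \<in> X" "snd (r (x, y)) \<in> X" if "x \<in> X" "y \<in> X" for x y
    using solutionD(2)[OF S that] by (auto simp: mem_Times_iff)
  have cl': "r' \<in> q ` X \<times> q ` X \<rightarrow> q ` X \<times> q ` X"
  proof (rule funcsetI)
    fix p assume "p \<in> q ` X \<times> q ` X"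
    then obtain x y where "p = (q x, q y)" "x \<in> X" "y \<in> X" by blast
    then show "r' p \<in> q ` X \<times> q ` X" using cl[of x y] by (simp add: hom mem_Times_iff)
  qed
  have non_deg: "\<exists>!p. p \<in> q ` X \<times> q ` X \<and> r' (a, fst p) = (b, snd p)"
    if a: "a \<in> q ` X" and b: "b \<in> q ` X" for a b
  proof -
    obtain x where x: "x \<in> X" "a = q x" using a by blast
    let ?f = "\<lambda>c. fst (r' (a, c))"
    have "?f ` q ` X = q ` (\<lambda>y. fst (r (x, y))) ` X"
      unfolding image_image by (rule image_cong) (simp_all add: x hom)
    also have "(\<lambda>y. fst (r (x, y))) ` X = X"
      using bij_betw_imp_surj_on[OF sigma_bij[OF S x(1)]] by (simp add: sigma_def)
    finally have im: "?f ` q ` X = q ` X" .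
    have inj: "inj_on ?f (q ` X)"
      by (rule eq_card_imp_inj_on) (simp add: solutionD(1)[OF S], simp only: im)
    have "b \<in> ?f ` q ` X" using b by (simp only: im)
    then obtain c where c: "c \<in> q ` X" "?f c = b" by (elim imageE) auto
    show ?thesis
    proof (rule ex1I)
      have "r' (a, c) \<in> q ` X \<times> q ` X" by (rule funcset_mem[OF cl']) (simp add: a c(1))
      then show "(c, snd (r' (a, c))) \<in> q ` X \<times> q ` X
          \<and> r' (a, fst (c, snd (r' (a, c)))) = (b, snd (c, snd (r' (a, c))))"
        using c by (simp add: mem_Times_iff prod_eq_iff)
    next
      fix p assume p: "p \<in> q ` X \<times> q ` X \<and> r' (a, fst p) = (b, snd p)"
      have "?f (fst p) = ?f c" using p c(2) by simp
      then have "fst p = c" by (rule inj_onD[OF inj]) (use p c in \<open>simp_all add: mem_Times_iff\<close>)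
      then show "p = (c, snd (r' (a, c)))" using p by (cases p) simp
    qed
  qed
  have invol: "r' (r' p) = p" if p: "p \<in> q ` X \<times> q ` X" for p
  proof -
    obtain x y where xy: "p = (q x, q y)" "x \<in> X" "y \<in> X" using p by blast
    obtain k l where kl: "r (x, y) = (k, l)" "k \<in> X" "l \<in> X"
      using cl[OF xy(2,3)] by (cases "r (x, y)") simp
    then have "r (k, l) = (x, y)" using solutionD(3)[OF S xy(2,3)] by simp
    then show ?thesis using xy kl by (simp add: hom)
  qed
  have braid: "(r12 r' \<circ> r23 r' \<circ> r12 r') t = (r23 r' \<circ> r12 r' \<circ> r23 r') t"
    if t: "t \<in> q ` X \<times> q ` X \<times> q ` X" for t
  proof -
    define Q where "Q = map_prod q (map_prod q q)"
    have 1: "r12 r' (Q s) = Q (r12 r s)" "r23 r' (Q s) = Q (r23 r s)"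
      "r12 r s \<in> X \<times> X \<times> X" "r23 r s \<in> X \<times> X \<times> X" if "s \<in> X \<times> X \<times> X" for s
      using that cl by (cases s; simp add: Q_def r12_def r23_def hom split_beta mem_Times_iff)+
    obtain x y z where xyz: "x \<in> X" "y \<in> X" "z \<in> X" "t = Q (x, y, z)"
      using t by (auto simp: Q_def)
    then show ?thesis using solutionD(5)[OF S, of x y z] by (simp add: 1)
  qed
  have "ybe_solution (q ` X, r')"
    unfolding ybe_solution_def
    using solutionD(1)[OF S] cl' invol non_deg braid by (simp del: comp_apply)
  moreover have "square_free (q ` X, r')" using sf by (auto simp: square_free_def hom)
  moreover have "\<forall>x\<in>q ` X. \<forall>y\<in>q ` X. \<forall>z\<in>q ` X. sigma (q ` X, r') x (sigma (q ` X, r') y z)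
      = sigma (q ` X, r') y (sigma (q ` X, r') x z)"
  proof (intro ballI, elim imageE)
    fix a b c x y z assume "a = q x" "b = q y" "c = q z" and mem: "x \<in> X" "y \<in> X" "z \<in> X"
    moreover have "fst (r (x, fst (r (y, z)))) = fst (r (y, fst (r (x, z))))"
      using A mem cl by (simp add: abelian_sqfree_def)
    ultimately show "sigma (q ` X, r') a (sigma (q ` X, r') b c)
      = sigma (q ` X, r') b (sigma (q ` X, r') a c)"
      using cl by (simp add: hom)
  qed
  ultimately show ?thesis by (simp add: abelian_sqfree_def)
qed

section \<open>Iterating the retraction\<close>

lemma transport_apply:
  assumes "inj_on f X" "x \<in> X" "y \<in> X"
  shows "snd (transport f (X, r)) (f x, f y) = map_prod f f (r (x, y))"
  using assms by (simp add: transport_def)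

text \<open>The quotient map followed by the encoding of classes; along it the retraction is a homomorphic
  image of the solution.\<close>
definition nested_class :: "'a nested sol \<Rightarrow> 'a nested \<Rightarrow> 'a nested" where
  "nested_class S x = Class (Abs_fset (rho S `` {x}))"

lemma nested_class_eq:
  assumes "ybe_solution (X, r)" and "(x, y) \<in> rho (X, r)"
  shows "nested_class (X, r) x = nested_class (X, r) y"
  using equiv_class_eq[OF rho_equiv[OF assms(1)] assms(2)] by (simp add: nested_class_def)

text \<open>
  Compatibility of \<open>\<rho>\<close> makes the description in \<^const>\<open>ret_map\<close> uniquely satisfied, and the encoding
  of classes is injective because they are finite.
\<close>
lemma Ret_nested_image:
  assumes A: "abelian_sqfree (X, r)"
  shows "fst (Ret_nested (X, r)) = nested_class (X, r) ` X"
    and "x \<in> X \<Longrightarrow> y \<in> X \<Longrightarrow>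
      snd (Ret_nested (X, r)) (nested_class (X, r) x, nested_class (X, r) y)
        = map_prod (nested_class (X, r)) (nested_class (X, r)) (r (x, y))"
proof -
  have S: "ybe_solution (X, r)" using A by (simp add: abelian_sqfree_def)
  note eq = rho_equiv[OF S]
  let ?R = "rho (X, r)"
  let ?f = "\<lambda>A. Class (Abs_fset A)"
  let ?C = "\<lambda>x. ?R `` {x}"
  have Q: "X // ?R = ?C ` X" by (auto simp: quotient_def)
  have "?R \<subseteq> X \<times> X" by (auto simp: rho_def)
  then have fin: "finite B" if "B \<in> X // ?R" for B
    using that solutionD(1)[OF S] by (auto simp: quotient_def intro: finite_subset[of _ X])
  have inj: "inj_on ?f (X // ?R)"
    using fin by (auto simp: inj_on_def Abs_fset_inject)
  have ret: "ret_map (X, r) (?C x, ?C y) = map_prod ?C ?C (r (x, y))" if xy: "x \<in> X" "y \<in> X" for x y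
  proof -
    have self: "x \<in> ?C x" "y \<in> ?C y" using equiv_class_self[OF eq] xy by auto
    have same: "?C (fst (r (x', y'))) = ?C (fst (r (x, y)))" "?C (snd (r (x', y'))) = ?C (snd (r (x, y)))"
      if "x' \<in> ?C x" "y' \<in> ?C y" for x' y'
      using rho_compatible[OF A, of x x' y y'] that equiv_class_eq[OF eq] by auto
    have "(THE (C, D). \<exists>x'\<in>?C x. \<exists>y'\<in>?C y. \<exists>k l.
        snd (X, r) (x', y') = (k, l) \<and> C = ?C k \<and> D = ?C l) = map_prod ?C ?C (r (x, y))"
    proof (rule the_equality, goal_cases)
      case 1
      show ?case using self by (cases "r (x, y)") force
    next
      case (2 p)
      then show ?case using same by (cases "r (x, y)") (fastforce simp: split_beta prod_eq_iff)
    qed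
    then show ?thesis by (simp add: ret_map_def)
  qed
  show "fst (Ret_nested (X, r)) = nested_class (X, r) ` X"
    by (simp add: Ret_nested_def Ret_def transport_def Q image_image nested_class_def)
  assume xy: "x \<in> X" "y \<in> X"
  then have "snd (Ret_nested (X, r)) (?f (?C x), ?f (?C y))
      = map_prod ?f ?f (map_prod ?C ?C (r (x, y)))"
    using transport_apply[OF inj, of "?C x" "?C y" "ret_map (X, r)"]
    by (simp add: Ret_nested_def Ret_def Q ret)
  then show "snd (Ret_nested (X, r)) (nested_class (X, r) x, nested_class (X, r) y)
      = map_prod (nested_class (X, r)) (nested_class (X, r)) (r (x, y))"
    by (simp add: nested_class_def map_prod_def split_beta)
qed

lemma Ret_nested_abelian_sqfree:
  assumes "abelian_sqfree S"
  shows "abelian_sqfree (Ret_nested S)"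
proof (cases S)
  case (Pair X r)
  then have A: "abelian_sqfree (X, r)" using assms by simp
  show ?thesis
    using abelian_sqfree_image[OF A Ret_nested_image(2)[OF A]]
    by (simp add: Pair flip: Ret_nested_image(1)[OF A])
qed

lemma Ret_nested_trivial:
  assumes A: "abelian_sqfree S" and T: "trivial_solution S"
  shows "trivial_solution (Ret_nested S)"
proof (cases S)
  case (Pair X r)
  then have A: "abelian_sqfree (X, r)" using assms by simp
  have T: "\<forall>x\<in>X. \<forall>y\<in>X. r (x, y) = (y, x)"
    using T by (simp add: Pair trivial_solution_def)
  show ?thesis
    unfolding Pair trivial_solution_def case_prod_beta Ret_nested_image(1)[OF A]
    using T by (auto simp: Ret_nested_image(2)[OF A])
qed

lemma card_Ret_nested_less:
  assumes A: "abelian_sqfree S" and N: "\<not> trivial_solution S"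
  shows "card (fst (Ret_nested S)) < card (fst S)"
proof (cases S)
  case (Pair X r)
  then have A: "abelian_sqfree (X, r)" and N: "\<not> trivial_solution (X, r)"
    using assms by simp_all
  have S: "ybe_solution (X, r)" using A by (simp add: abelian_sqfree_def)
  obtain x y where xy: "(x, y) \<in> rho (X, r)" "x \<noteq> y"
    using nontrivial_imp_rho_nontrivial[OF A N] by blast
  have fin: "finite X" using S by (rule solutionD)
  have "x \<in> X" "y \<in> X" using xy(1) by (simp_all add: rho_def)
  then have "\<not> inj_on (nested_class (X, r)) X"
    using xy(2) nested_class_eq[OF S xy(1)] by (auto dest: inj_onD)
  then have "card (nested_class (X, r) ` X) \<noteq> card X"
    using eq_card_imp_inj_on[OF fin] by blast
  then have "card (nested_class (X, r) ` X) < card X"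
    using card_image_le[OF fin, of "nested_class (X, r)"] by simp
  then show ?thesis by (simp add: Pair Ret_nested_image(1)[OF A])
qed

text \<open>
  A solution that is trivial from the outset is retracted once, which keeps it trivial, to meet the
  bound \<open>m \<ge> 1\<close>.
\<close>
lemma ex_trivial_iterate:
  assumes "abelian_sqfree S"
  shows "\<exists>m\<ge>1. trivial_solution ((Ret_nested ^^ m) S)"
  using assms
proof (induction "card (fst S)" arbitrary: S rule: less_induct)
  case less
  show ?case
  proof (cases "trivial_solution S")
    case True
    then have "trivial_solution ((Ret_nested ^^ 1) S)" using Ret_nested_trivial less.prems by simp
    then show ?thesis by blast
  next
    case False
    then obtain m where "trivial_solution ((Ret_nested ^^ m) (Ret_nested S))"
      using less.hyps[OF card_Ret_nested_less Ret_nested_abelian_sqfree] less.prems by blast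
    then have "trivial_solution ((Ret_nested ^^ Suc m) S)" by (simp add: funpow_swap1)
    then show ?thesis by (intro exI[of _ "Suc m"]) simp
  qed
qed

lemma comm_IYB_group_imp_sigma_commute:
  assumes S: "ybe_solution (X, r)" and "comm_group (IYB_group (X, r))"
    and "x \<in> X" "y \<in> X" "z \<in> X"
  shows "sigma (X, r) x (sigma (X, r) y z) = sigma (X, r) y (sigma (X, r) x z)"
proof -
  interpret comm_group "IYB_group (X, r)" by fact
  let ?s = "sigma (X, r)"
  have "?s x \<in> carrier (IYB_group (X, r))" "?s y \<in> carrier (IYB_group (X, r))"
    using assms(3,4) by (auto simp: IYB_group_def intro: generate.incl)
  then have "compose X (?s x) (?s y) = compose X (?s y) (?s x)"
    using m_comm[of "?s x" "?s y"] sigma_in_Bij[OF S] assms(3,4)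
    by (simp add: IYB_group_def BijGroup_def)
  from fun_cong[OF this, of z] show ?thesis using \<open>z \<in> X\<close> by (simp only: compose_eq)
qed

theorem corollary2p9:
  fixes X :: "'a set" and r :: "'a \<times> 'a \<Rightarrow> 'a \<times> 'a"
  assumes "ybe_solution (X, r)"
    and "square_free (X, r)"
    and "card X > 1"
    and "comm_group (IYB_group (X, r))"
  shows "strongly_retractable (X, r)"
proof -
  have A: "abelian_sqfree (X, r)"
    unfolding abelian_sqfree_def fst_conv
    using assms(1,2) comm_IYB_group_imp_sigma_commute[OF assms(1,4)] by blast
  have "abelian_sqfree (Elem ` X, snd (transport Elem (X, r)))"
    by (rule abelian_sqfree_image[OF A]) (rule transport_apply, auto simp: inj_on_def)
  moreover have "transport Elem (X, r) = (Elem ` X, snd (transport Elem (X, r)))"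
    by (simp add: transport_def)
  ultimately have "abelian_sqfree (transport Elem (X, r))" by (simp only:)
  then show ?thesis unfolding strongly_retractable_def by (rule ex_trivial_iterate)
qed

end
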